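(* For any function $f\colon\omega\to\omega\setminus\{0\}$ (in the ground model $V$) there is an $\mathbb{FSP}$-name $\tau$ (for an element of $\omega^\omega$) such that for any $f$-slalom $\langle S_n : n<\omega\rangle\in V$, \[ \mathbb{FSP}\Vdash (\exists^\infty n)(\tau(n)\notin S_n), \] where $\exists^\infty n$ means “there are infinitely many $n$''.
   Context: A tree is a nonempty set $p \subseteq 2^{<\omega}$ closed under initial segments ($\trianglelefteq$ denotes the initial segment relation and $\triangleleft$ its strict version; $|t|$ is the length of $t$). A node $t\in p$ is splitting if both $t^\frown 0, t^\frown 1 \in p$; $\mathrm{Split}(p)$ is the set of splitting nodes. $p$ is perfect if every node of $p$ is extended (not necessarily properly) by a splitting node of $p$. $\mathrm{Lev}_n(p)=\{t\in p: |t|=n\}$ and $p\upharpoonright t=\{s\in p : s\trianglelefteq t \text{ or } t\triangleleft s\}$. $\mathbb{FSP}$ (fat splitting tree forcing) is the set of perfect trees $p\subseteq 2^{<\omega}$ such that for every $t\in p$ there is $k\in\omega$ such that for every $n\in\omega$ with $n\ge k-1$ there is $t'\in \mathrm{Lev}_n(p\upharpoonright t)$ with $t'\in\mathrm{Split}(p)$; ordered by $q\le p$ iff $q\subseteq p$. An $f$-slalom is a sequence $\langle S_n:n<\omega\rangle$ of sets $S_n\subseteq\omega$ with $|S_n|\le f(n)$ for all $n$. *)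

theory Defs
  imports "HOL-Library.Sublist" "HOL-Library.Multiset"
begin

section \<open>Names\<close>

text \<open>
  A forcing notion is a set \<open>P\<close> of elements of a type of class \<open>order_top\<close>, ordered by \<open>\<le>\<close>
  (smaller is stronger) with \<open>top\<close> as its largest element.  The ground model is the ambient
  universe of HOL.

  A name is a set of pairs (name, condition).  As HOL has no datatype closed under arbitrary sets,
  such a set is given here as the range of a partial function on \<open>nat \<times> 'p\<close>; these are the names
  that are hereditarily of size at most the cardinality of \<open>nat \<times> 'p\<close>.  All nice names for reals,
  and the canonical names of natural numbers, of sets of natural numbers and of sequences of such,
  are of this kind.
\<close>

datatype 'p name = Name "nat \<times> 'p \<Rightarrow> ('p name \<times> 'p) option"

fun elts :: "'p name \<Rightarrow> ('p name \<times> 'p) set" where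
  "elts (Name f) = ran f"

inductive is_name :: "'p set \<Rightarrow> 'p name \<Rightarrow> bool" for P where
  "(\<And>\<sigma> r. (\<sigma>, r) \<in> elts \<tau> \<Longrightarrow> r \<in> P \<and> is_name P \<sigma>) \<Longrightarrow> is_name P \<tau>"

definition child :: "('p name \<times> 'p name) set" where
  "child = {(\<sigma>, \<tau>). \<exists>r. (\<sigma>, r) \<in> elts \<tau>}"

lemma wf_child: "wf (child :: ('p name \<times> 'p name) set)"
proof -
  have "\<forall>x. (\<forall>y. (y, x) \<in> child \<longrightarrow> Q y) \<longrightarrow> Q x \<Longrightarrow> Q x" for Q and x :: "'p name"
  proof (induction x)
    case (Name f)
    have "Q y" if "(y, Name f) \<in> child" for y
    proof -
      from that obtain r i where i: "f i = Some (y, r)"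
        by (auto simp: child_def ran_def)
      show ?thesis
        using Name.IH[of "f i" "(y, r)" y] Name.prems i
        by (metis elem_set fsts.intros option.set_intros rangeI fst_conv)
    qed
    with Name.prems show ?case by blast
  qed
  then show ?thesis unfolding wf_def by blast
qed

section \<open>The forcing relation\<close>

definition dense_below :: "'p::order set \<Rightarrow> 'p \<Rightarrow> ('p \<Rightarrow> bool) \<Rightarrow> bool" where
  "dense_below P p D \<longleftrightarrow> (\<forall>q\<in>P. q \<le> p \<longrightarrow> (\<exists>r\<in>P. r \<le> q \<and> D r))"

lemma dense_below_cong [fundef_cong]:
  "P = P' \<Longrightarrow> p = p' \<Longrightarrow> (\<And>r. D r = D' r) \<Longrightarrow> dense_below P p D = dense_below P' p' D'"
  by (simp add: dense_below_def)

function forces_eq :: "'p::order set \<Rightarrow> 'p \<Rightarrow> 'p name \<Rightarrow> 'p name \<Rightarrow> bool"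
  and forces_mem :: "'p::order set \<Rightarrow> 'p \<Rightarrow> 'p name \<Rightarrow> 'p name \<Rightarrow> bool"
where
  "forces_eq P p \<sigma> \<tau> \<longleftrightarrow>
     (\<forall>(\<pi>, r)\<in>elts \<sigma>. \<forall>q\<in>P. q \<le> p \<and> q \<le> r \<longrightarrow> forces_mem P q \<pi> \<tau>) \<and>
     (\<forall>(\<pi>, r)\<in>elts \<tau>. \<forall>q\<in>P. q \<le> p \<and> q \<le> r \<longrightarrow> forces_mem P q \<pi> \<sigma>)"
| "forces_mem P p \<sigma> \<tau> \<longleftrightarrow>
     dense_below P p (\<lambda>q. \<exists>(\<pi>, r)\<in>elts \<tau>. q \<le> r \<and> forces_eq P q \<sigma> \<pi>)"
  by pat_completeness auto
termination
proof -
  let ?m = "\<lambda>x :: ('a set \<times> 'a \<times> 'a name \<times> 'a name) + ('a set \<times> 'a \<times> 'a name \<times> 'a name).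
              case x of Inl (_, _, \<sigma>, \<tau>) \<Rightarrow> {#\<sigma>, \<tau>#} | Inr (_, _, \<sigma>, \<tau>) \<Rightarrow> {#\<sigma>, \<tau>#}"
  have left: "({#\<pi>, \<tau>#}, {#\<sigma>, \<tau>#}) \<in> mult child" if "(\<pi>, r) \<in> elts \<sigma>" for \<pi> \<sigma> \<tau> :: "'a name" and r
    unfolding mult_def
    by (rule r_into_trancl, rule mult1I[of _ \<sigma> "{#\<tau>#}" _ "{#\<pi>#}"]) (use that in \<open>auto simp: child_def\<close>)
  have right: "({#\<sigma>, \<pi>#}, {#\<sigma>, \<tau>#}) \<in> mult child" if "(\<pi>, r) \<in> elts \<tau>" for \<pi> \<sigma> \<tau> :: "'a name" and r
    using left[OF that, of \<sigma>] by (simp add: add_mset_commute)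
  have right': "({#\<pi>, \<sigma>#}, {#\<sigma>, \<tau>#}) \<in> mult child" if "(\<pi>, r) \<in> elts \<tau>" for \<pi> \<sigma> \<tau> :: "'a name" and r
    using left[OF that, of \<sigma>] by (simp add: add_mset_commute)
  show ?thesis
    by (relation "inv_image (mult child) ?m")
       (auto intro: wf_mult wf_child left right right')
qed

text \<open>
  Sentences of the forcing language with bounded quantifiers, in higher-order abstract syntax; names
  serve as their own constant symbols.
\<close>

datatype 'p fm =
    Mem "'p name" "'p name"
  | Equal "'p name" "'p name"
  | Neg "'p fm"
  | And "'p fm" "'p fm"
  | Ball_in "'p name" "'p name \<Rightarrow> 'p fm"

definition Bex_in :: "'p name \<Rightarrow> ('p name \<Rightarrow> 'p fm) \<Rightarrow> 'p fm" where
  "Bex_in \<sigma> \<phi> = Neg (Ball_in \<sigma> (\<lambda>x. Neg (\<phi> x)))"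

definition Imp :: "'p fm \<Rightarrow> 'p fm \<Rightarrow> 'p fm" where
  "Imp \<phi> \<psi> = Neg (And \<phi> (Neg \<psi>))"

primrec forces :: "'p::order set \<Rightarrow> 'p fm \<Rightarrow> 'p \<Rightarrow> bool" where
  "forces P (Mem \<sigma> \<tau>) = (\<lambda>p. forces_mem P p \<sigma> \<tau>)"
| "forces P (Equal \<sigma> \<tau>) = (\<lambda>p. forces_eq P p \<sigma> \<tau>)"
| "forces P (Neg \<phi>) = (\<lambda>p. \<forall>q\<in>P. q \<le> p \<longrightarrow> \<not> forces P \<phi> q)"
| "forces P (And \<phi> \<psi>) = (\<lambda>p. forces P \<phi> p \<and> forces P \<psi> p)"
| "forces P (Ball_in \<sigma> \<phi>) =
     (\<lambda>p. \<forall>(\<pi>, r)\<in>elts \<sigma>. \<forall>q\<in>P. q \<le> p \<and> q \<le> r \<longrightarrow> forces P (\<phi> \<pi>) q)"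

definition forced :: "'p::order set \<Rightarrow> 'p fm \<Rightarrow> bool" (infix "\<tturnstile>" 40) where
  "P \<tturnstile> \<phi> \<longleftrightarrow> (\<forall>p\<in>P. forces P \<phi> p)"

section \<open>Canonical names\<close>

text \<open>The name \<open>{(s i, top) | i}\<close>.\<close>

definition seq_name :: "(nat \<Rightarrow> 'p::order_top name option) \<Rightarrow> 'p name" where
  "seq_name s = Name (\<lambda>(i, _). map_option (\<lambda>\<sigma>. (\<sigma>, top)) (s i))"

fun nat_name :: "nat \<Rightarrow> 'p::order_top name" where
  "nat_name n = seq_name (\<lambda>i. if i < n then Some (nat_name i) else None)"

declare nat_name.simps [simp del] forces_eq.simps [simp del] forces_mem.simps [simp del]

definition omega_name :: "'p::order_top name" where
  "omega_name = seq_name (\<lambda>i. Some (nat_name i))"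

definition nat_set_name :: "nat set \<Rightarrow> 'p::order_top name" where
  "nat_set_name A = seq_name (\<lambda>i. if i \<in> A then Some (nat_name i) else None)"

definition upair_name :: "'p::order_top name \<Rightarrow> 'p name \<Rightarrow> 'p name" where
  "upair_name \<sigma> \<tau> = seq_name [0 \<mapsto> \<sigma>, 1 \<mapsto> \<tau>]"

definition opair_name :: "'p::order_top name \<Rightarrow> 'p name \<Rightarrow> 'p name" where
  "opair_name \<sigma> \<tau> = upair_name (upair_name \<sigma> \<sigma>) (upair_name \<sigma> \<tau>)"

text \<open>The canonical name of a sequence of sets of natural numbers, and that of its range.\<close>

definition set_seq_name :: "(nat \<Rightarrow> nat set) \<Rightarrow> 'p::order_top name" where
  "set_seq_name S = seq_name (\<lambda>i. Some (opair_name (nat_name i) (nat_set_name (S i))))"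

definition set_seq_range_name :: "(nat \<Rightarrow> nat set) \<Rightarrow> 'p::order_top name" where
  "set_seq_range_name S = seq_name (\<lambda>i. Some (nat_set_name (S i)))"

text \<open>Functions are sets of Kuratowski pairs.\<close>

definition in_Baire :: "'p::order_top name \<Rightarrow> 'p fm" where
  "in_Baire \<tau> =
     And (Ball_in \<tau> (\<lambda>x. Bex_in omega_name (\<lambda>n. Bex_in omega_name (\<lambda>k. Equal x (opair_name n k)))))
    (And (Ball_in omega_name (\<lambda>n. Bex_in omega_name (\<lambda>k. Mem (opair_name n k) \<tau>)))
         (Ball_in omega_name (\<lambda>n. Ball_in omega_name (\<lambda>k. Ball_in omega_name (\<lambda>l.
            Imp (And (Mem (opair_name n k) \<tau>) (Mem (opair_name n l) \<tau>)) (Equal k l))))))"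

definition Infinitely_often :: "('p::order_top name \<Rightarrow> 'p fm) \<Rightarrow> 'p fm" where
  "Infinitely_often \<phi> = Ball_in omega_name (\<lambda>m. Bex_in omega_name (\<lambda>n. And (Mem m n) (\<phi> n)))"

text \<open>\<open>\<tau>(n) \<notin> S(n)\<close>; the range of \<open>S\<close> serves to bound the quantifier over the value \<open>S(n)\<close>.\<close>

definition escapes_at :: "'p::order_top name \<Rightarrow> (nat \<Rightarrow> nat set) \<Rightarrow> 'p name \<Rightarrow> 'p fm" where
  "escapes_at \<tau> S n =
     Bex_in omega_name (\<lambda>k. Bex_in (set_seq_range_name S) (\<lambda>s.
       And (Mem (opair_name n k) \<tau>) (And (Mem (opair_name n s) (set_seq_name S)) (Neg (Mem k s)))))"

section \<open>Fat splitting trees\<close>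

type_synonym node = "bool list"

definition is_tree :: "node set \<Rightarrow> bool" where
  "is_tree p \<longleftrightarrow> p \<noteq> {} \<and> (\<forall>t\<in>p. \<forall>s. prefix s t \<longrightarrow> s \<in> p)"

definition Split :: "node set \<Rightarrow> node set" where
  "Split p = {t \<in> p. t @ [False] \<in> p \<and> t @ [True] \<in> p}"

definition perfect :: "node set \<Rightarrow> bool" where
  "perfect p \<longleftrightarrow> is_tree p \<and> (\<forall>t\<in>p. \<exists>s\<in>Split p. prefix t s)"

definition Lev :: "nat \<Rightarrow> node set \<Rightarrow> node set" where
  "Lev n p = {t \<in> p. length t = n}"

definition restr :: "node set \<Rightarrow> node \<Rightarrow> node set" where
  "restr p t = {s \<in> p. prefix s t \<or> strict_prefix t s}"

text \<open>The bound \<open>n + 1 \<ge> k\<close> expresses \<open>n \<ge> k - 1\<close> without truncated subtraction.\<close>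

definition FSP :: "node set set" where
  "FSP = {p. perfect p \<and>
     (\<forall>t\<in>p. \<exists>k. \<forall>n. n + 1 \<ge> k \<longrightarrow> (\<exists>t'\<in>Lev n (restr p t). t' \<in> Split p))}"

text \<open>The order \<open>\<le>\<close> on \<^typ>\<open>node set\<close> is inclusion, and \<open>top\<close> is the full binary tree.\<close>

lemma top_in_FSP: "top \<in> FSP"
proof -
  have "\<exists>t'. length t' = n \<and> (prefix t' t \<or> strict_prefix t t')" if "length t \<le> n" for n :: nat and t :: node
    using that
    by (intro exI[of _ "t @ replicate (n - length t) False"]) (auto simp: strict_prefix_def)
  then show ?thesis
    unfolding FSP_def perfect_def is_tree_def Split_def Lev_def restr_def
    by (auto intro!: exI[of _ "Suc (length _)"])
qed

section \<open>Slaloms\<close>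

definition slalom :: "(nat \<Rightarrow> nat) \<Rightarrow> (nat \<Rightarrow> nat set) \<Rightarrow> bool" where
  "slalom f S \<longleftrightarrow> (\<forall>n. finite (S n) \<and> card (S n) \<le> f n)"

end

theory Submission
  imports Defs "HOL-Library.Countable"
begin

text \<open>
  The witness codes longer and longer initial segments of the generic branch: \<open>\<tau>(n)\<close> is the code of
  the initial segment of length \<open>n + f n\<close>.  What makes it escape is a count.  The fatness condition
  at the root says that, from some \<open>k\<close> on, every level of a condition \<open>p\<close> contains a splitting
  node, so each level has at least one node more than the preceding one
  (\<open>card_Lev_ge\<close>).  Hence level \<open>n + f n\<close> of \<open>p\<close> has more than \<open>f n\<close> nodes as soon as \<open>n \<ge> k\<close>, and
  one of them, say \<open>t\<close>, has its code outside \<open>S n\<close>.  The restriction of \<open>p\<close> to \<open>t\<close>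
  is again a condition (\<open>restr_in_FSP\<close>), and it forces \<open>\<tau>(n)\<close> to be the code of \<open>t\<close>.
  Since \<open>n\<close> can be taken arbitrarily large, this happens infinitely often.

  To carry this out in the forcing relation, two facts about names are needed.  Forced equality
  is reflexive (\<open>forces_eq_refl\<close>), which yields all positive statements.  For the negative ones --
  that \<open>\<tau>\<close> is single-valued, and that a number outside \<open>S n\<close> is not forced into \<open>S n\<close> -- distinct
  numbers, or pairs of numbers, must have canonical names that no condition can force to be
  equal.  That is proved by working with the relation ``some condition forces equality'', under which
  every element of one canonical name has a partner in the other (\<open>possibly_eq_elts\<close>), so that the
  usual proofs for von Neumann numerals and Kuratowski pairs go through.
\<close>

section \<open>Forcing with arbitrary conditions\<close>

lemma forces_eq_sym: "forces_eq P p \<sigma> \<tau> \<Longrightarrow> forces_eq P p \<tau> \<sigma>"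
  by (subst forces_eq.simps, subst (asm) forces_eq.simps) blast

lemma forces_eq_refl: "forces_eq P p \<sigma> \<sigma>"
proof (induction \<sigma> arbitrary: p rule: wf_induct_rule[OF wf_child])
  case (1 \<sigma>)
  have "forces_mem P q \<pi> \<sigma>" if "(\<pi>, r) \<in> elts \<sigma>" "q \<le> r" for \<pi> q r
  proof -
    have "(\<pi>, \<sigma>) \<in> child"
      using that by (auto simp: child_def)
    then have "forces_eq P q' \<pi> \<pi>" for q'
      by (rule 1)
    then show ?thesis
      using that unfolding forces_mem.simps[of P q] dense_below_def
      by (blast intro: order_trans)
  qed
  then show ?case
    unfolding forces_eq.simps[of P p] by blast
qed

lemma forces_memI: "(\<sigma>, r) \<in> elts \<tau> \<Longrightarrow> p \<le> r \<Longrightarrow> forces_mem P p \<sigma> \<tau>"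
  unfolding forces_mem.simps[of P p] dense_below_def
  by (blast intro: forces_eq_refl order_trans)

lemma forces_memE:
  assumes "forces_mem P p \<sigma> \<tau>" "q \<in> P" "q \<le> p"
  obtains \<pi> r q' where "(\<pi>, r) \<in> elts \<tau>" "q' \<in> P" "q' \<le> q" "q' \<le> r" "forces_eq P q' \<sigma> \<pi>"
  using assms unfolding forces_mem.simps[of P p] dense_below_def by blast

text \<open>
  Unfolding the definition strengthens the condition twice, once for the inner quantifier and once
  for the inner negation; both steps merge into the single one that density provides.
\<close>

lemma forces_Bex_in:
  "forces P (Bex_in \<sigma> \<phi>) p \<longleftrightarrow>
     dense_below P p (\<lambda>q. \<exists>(\<pi>, r)\<in>elts \<sigma>. q \<le> r \<and> forces P (\<phi> \<pi>) q)"
proof -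
  have "\<not> (\<forall>(\<pi>, r)\<in>elts \<sigma>. \<forall>q'\<in>P. q' \<le> q \<and> q' \<le> r \<longrightarrow> (\<forall>q''\<in>P. q'' \<le> q' \<longrightarrow> \<not> forces P (\<phi> \<pi>) q'')) \<longleftrightarrow>
      (\<exists>q'\<in>P. q' \<le> q \<and> (\<exists>(\<pi>, r)\<in>elts \<sigma>. q' \<le> r \<and> forces P (\<phi> \<pi>) q'))"
    (is "\<not> ?L \<longleftrightarrow> ?R") for q
  proof
    assume "\<not> ?L"
    then obtain \<pi> r q' q'' where w: "(\<pi>, r) \<in> elts \<sigma>" "q'' \<in> P" "q' \<le> q" "q' \<le> r" "q'' \<le> q'"
      "forces P (\<phi> \<pi>) q''"
      by auto
    then have "q'' \<le> q" "q'' \<le> r"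
      by (auto intro: order_trans[OF w(5)])
    with w show ?R
      by (intro bexI[of _ q''] conjI bexI[of _ "(\<pi>, r)"]) auto
  next
    assume ?R
    then obtain \<pi> r q' where "(\<pi>, r) \<in> elts \<sigma>" "q' \<in> P" "q' \<le> q" "q' \<le> r" "forces P (\<phi> \<pi>) q'"
      by auto
    then show "\<not> ?L"
      using order_refl by (auto dest!: bspec)
  qed
  then show ?thesis
    unfolding Bex_in_def dense_below_def forces.simps
    by (intro ball_cong refl imp_cong)
qed

lemma forces_Bex_inI:
  fixes P :: "'p::order_top set"
  assumes "(\<pi>, top) \<in> elts \<sigma>" "\<And>q. q \<le> p \<Longrightarrow> forces P (\<phi> \<pi>) q"
  shows "forces P (Bex_in \<sigma> \<phi>) p"
  unfolding forces_Bex_in dense_below_def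
proof (intro ballI impI)
  fix q assume "q \<in> P" "q \<le> p"
  then show "\<exists>r\<in>P. r \<le> q \<and> (\<exists>(\<pi>, r')\<in>elts \<sigma>. r \<le> r' \<and> forces P (\<phi> \<pi>) r)"
    using assms by (intro bexI[of _ q] conjI bexI[of _ "(\<pi>, top)"]) auto
qed

section \<open>Canonical names\<close>

lemma elts_seq_name: "elts (seq_name s) = (\<lambda>\<sigma>. (\<sigma>, top)) ` ran s"
  by (auto simp: seq_name_def ran_def)

lemma elts_nat_name: "elts (nat_name n) = (\<lambda>i. (nat_name i, top)) ` {..<n}"
  by (subst nat_name.simps) (auto simp: elts_seq_name ran_def)

lemma elts_omega_name: "elts omega_name = range (\<lambda>i. (nat_name i, top))"
  by (auto simp: omega_name_def elts_seq_name ran_def)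

lemma nat_name_in_omega_name: "(nat_name n, top) \<in> elts omega_name"
  by (auto simp: elts_omega_name)

lemma elts_nat_set_name: "elts (nat_set_name A) = (\<lambda>i. (nat_name i, top)) ` A"
  by (auto simp: nat_set_name_def elts_seq_name ran_def)

lemma elts_upair_name: "elts (upair_name \<sigma> \<tau>) = {(\<sigma>, top), (\<tau>, top)}"
  by (auto simp: upair_name_def elts_seq_name)

lemma is_name_nat_name: "top \<in> P \<Longrightarrow> is_name P (nat_name n)"
proof (induction n rule: less_induct)
  case (less n)
  then show ?case
    by (intro is_name.intros[of "nat_name n"]) (auto simp: elts_nat_name)
qed

lemma is_name_opair_name:
  assumes "top \<in> P" "is_name P \<sigma>" "is_name P \<tau>"
  shows "is_name P (opair_name \<sigma> \<tau>)"
proof -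
  have "is_name P (upair_name \<sigma> \<tau>)" if "is_name P \<sigma>" "is_name P \<tau>" for \<sigma> \<tau>
    by (rule is_name.intros) (use that assms(1) in \<open>auto simp: elts_upair_name\<close>)
  then show ?thesis
    using assms by (simp add: opair_name_def)
qed

section \<open>Canonical names of different objects are never forced equal\<close>

text \<open>
  Passing from ``\<open>p\<close> forces equality'' to ``some condition forces equality'' absorbs the strengthening
  of conditions that comes with every unfolding of forced membership.
\<close>

definition possibly_eq :: "'p::order set \<Rightarrow> 'p name \<Rightarrow> 'p name \<Rightarrow> bool" where
  "possibly_eq P \<sigma> \<tau> \<longleftrightarrow> (\<exists>p\<in>P. forces_eq P p \<sigma> \<tau>)"

lemma possibly_eq_sym: "possibly_eq P \<sigma> \<tau> \<Longrightarrow> possibly_eq P \<tau> \<sigma>"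
  unfolding possibly_eq_def by (blast intro: forces_eq_sym)

lemma possibly_eq_elts:
  fixes P :: "'p::order_top set"
  assumes "possibly_eq P \<sigma> \<tau>" "(\<pi>, top) \<in> elts \<sigma>"
  obtains \<rho> r where "(\<rho>, r) \<in> elts \<tau>" "possibly_eq P \<pi> \<rho>"
proof -
  obtain p where p: "p \<in> P" "forces_eq P p \<sigma> \<tau>"
    using assms(1) by (auto simp: possibly_eq_def)
  then have "forces_mem P p \<pi> \<tau>"
    using assms(2) unfolding forces_eq.simps[of P p] by force
  from this p(1) order_refl show thesis
    by (rule forces_memE) (use that in \<open>auto simp: possibly_eq_def\<close>)
qed

lemma possibly_eq_nat_nameD: "possibly_eq P (nat_name i) (nat_name j) \<Longrightarrow> i = j"
proof (induction i arbitrary: j rule: less_induct)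
  case (less i)
  show ?case
  proof (cases i j rule: linorder_cases)
    case less': less
    \<comment> \<open>\<open>i\<close> is a member of \<open>j\<close>, hence possibly equal to a member of \<open>i\<close>, which is smaller.\<close>
    then obtain i' where "i' < i" "possibly_eq P (nat_name i) (nat_name i')"
      using possibly_eq_elts[OF possibly_eq_sym[OF less.prems], of "nat_name i"]
      by (auto simp: elts_nat_name)
    then show ?thesis
      using less.IH[of i' i] possibly_eq_sym by blast
  next
    case greater
    then obtain j' where "j' < j" "possibly_eq P (nat_name j) (nat_name j')"
      using possibly_eq_elts[OF less.prems, of "nat_name j"]
      by (auto simp: elts_nat_name)
    then show ?thesis
      using less.IH[of j j'] greater by auto
  qed
qed

lemma possibly_eq_upair_nameD:
  assumes "possibly_eq P (upair_name a b) (upair_name c d)"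
  shows "possibly_eq P a c \<or> possibly_eq P a d" "possibly_eq P b c \<or> possibly_eq P b d"
    "possibly_eq P a c \<or> possibly_eq P b c" "possibly_eq P a d \<or> possibly_eq P b d"
proof -
  show "possibly_eq P a c \<or> possibly_eq P a d"
    by (rule possibly_eq_elts[OF assms, of a]) (auto simp: elts_upair_name)
  show "possibly_eq P b c \<or> possibly_eq P b d"
    by (rule possibly_eq_elts[OF assms, of b]) (auto simp: elts_upair_name)
  show "possibly_eq P a c \<or> possibly_eq P b c"
    by (rule possibly_eq_elts[OF possibly_eq_sym[OF assms], of c])
      (auto simp: elts_upair_name intro: possibly_eq_sym)
  show "possibly_eq P a d \<or> possibly_eq P b d"
    by (rule possibly_eq_elts[OF possibly_eq_sym[OF assms], of d])
      (auto simp: elts_upair_name intro: possibly_eq_sym)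
qed

lemma possibly_eq_opair_nat_nameD:
  assumes "possibly_eq P (opair_name (nat_name a) (nat_name b)) (opair_name (nat_name c) (nat_name d))"
  shows "a = c \<and> b = d"
proof -
  have upair: "{a, b} = {c, d}"
    if "possibly_eq P (upair_name (nat_name a) (nat_name b)) (upair_name (nat_name c) (nat_name d))"
    for a b c d
    using possibly_eq_upair_nameD[OF that] by (auto dest!: possibly_eq_nat_nameD)
  note pairs = possibly_eq_upair_nameD[OF assms[unfolded opair_name_def]]
  have "{a, a} = {c, c} \<or> {a, a} = {c, d}"
    using pairs(1) by (rule disj_forward) (erule upair)+
  moreover have "{a, b} = {c, c} \<or> {a, b} = {c, d}"
    using pairs(2) by (rule disj_forward) (erule upair)+
  moreover have "{a, a} = {c, d} \<or> {a, b} = {c, d}"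
    using pairs(4) by (rule disj_forward) (erule upair)+
  ultimately show ?thesis
    by (auto simp: doubleton_eq_iff)
qed

lemma not_forces_mem_nat_set_name:
  assumes "k \<notin> A" "p \<in> P"
  shows "\<not> forces_mem P p (nat_name k) (nat_set_name A)"
proof
  assume "forces_mem P p (nat_name k) (nat_set_name A)"
  from this assms(2) order_refl obtain i where "i \<in> A" "possibly_eq P (nat_name k) (nat_name i)"
    by (rule forces_memE) (auto simp: elts_nat_set_name possibly_eq_def)
  then show False
    using assms(1) by (auto dest: possibly_eq_nat_nameD)
qed

section \<open>Levels and restrictions of fat splitting trees\<close>

lemma FSP_perfect: "p \<in> FSP \<Longrightarrow> perfect p"
  by (simp add: FSP_def)

lemma FSP_is_tree: "p \<in> FSP \<Longrightarrow> is_tree p"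
  by (simp add: FSP_def perfect_def)

lemma FSP_fat:
  assumes "p \<in> FSP" "t \<in> p"
  obtains k where "\<And>n. n + 1 \<ge> k \<Longrightarrow> \<exists>t'\<in>Lev n (restr p t). t' \<in> Split p"
  using assms unfolding FSP_def by blast

lemma is_tree_prefix: "is_tree p \<Longrightarrow> t \<in> p \<Longrightarrow> prefix s t \<Longrightarrow> s \<in> p"
  by (auto simp: is_tree_def)

lemma Nil_in_tree: "is_tree p \<Longrightarrow> [] \<in> p"
  unfolding is_tree_def by (metis Nil_prefix ex_in_conv)

lemma finite_Lev: "finite (Lev n p)"
  by (rule finite_subset[OF _ finite_lists_length_eq[of "UNIV :: bool set" n]]) (auto simp: Lev_def)

lemma restr_iff: "s \<in> restr p t \<longleftrightarrow> s \<in> p \<and> (prefix s t \<or> prefix t s)"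
  by (auto simp: restr_def strict_prefix_def)

lemma perfect_extend:
  assumes "perfect p" "t \<in> p"
  shows "\<exists>b. t @ [b] \<in> p"
proof -
  obtain s where s: "s \<in> Split p" "prefix t s"
    using assms by (auto simp: perfect_def)
  show ?thesis
  proof (cases "s = t")
    case True
    then have "t @ [True] \<in> p" using s by (simp add: Defs.Split_def)
    then show ?thesis ..
  next
    case False
    obtain v where "s = t @ v"
      using s(2) by (rule prefixE)
    with False obtain b u where "s = t @ b # u"
      by (cases v) auto
    then have "prefix (t @ [b]) s" by simp
    then show ?thesis
      using assms s by (auto simp: perfect_def Defs.Split_def dest: is_tree_prefix)
  qed
qed

text \<open>
  Every node has a successor, and a splitting node has two.
\<close>

lemma card_Lev_Suc:
  assumes "perfect p" "s \<in> Lev n p" "s \<in> Split p"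
  shows "card (Lev n p) < card (Lev (Suc n) p)"
proof -
  obtain e where e: "\<And>t. t \<in> p \<Longrightarrow> t @ [e t] \<in> p"
    using perfect_extend[OF assms(1)] by metis
  let ?g = "\<lambda>t. t @ [e t]"
  \<comment> \<open>The successor of \<open>s\<close> that the choice function \<open>e\<close> misses.\<close>
  let ?s' = "s @ [\<not> e s]"
  have "inj_on ?g (Lev n p)"
    by (auto simp: inj_on_def)
  then have "card (Lev n p) = card (?g ` Lev n p)"
    by (simp add: card_image)
  also have "?s' \<notin> ?g ` Lev n p"
  proof
    assume "?s' \<in> ?g ` Lev n p"
    then obtain t where "s @ [\<not> e s] = t @ [e t]"
      by (rule imageE)
    then show False
      \<comment> \<open>The equation gives \<open>s = t\<close>, and then the last entries differ.\<close>
      unfolding append1_eq_conv by (elim conjE) simp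
  qed
  then have "card (?g ` Lev n p) < card (insert ?s' (?g ` Lev n p))"
    by (simp add: finite_Lev)
  also have "\<dots> \<le> card (Lev (Suc n) p)"
  proof (intro card_mono finite_Lev insert_subsetI image_subsetI)
    show "?s' \<in> Lev (Suc n) p"
      using assms(2,3) by (cases "e s") (simp_all add: Lev_def Defs.Split_def)
    show "?g t \<in> Lev (Suc n) p" if "t \<in> Lev n p" for t
      using that e by (simp add: Lev_def)
  qed
  finally show ?thesis .
qed

text \<open>
  From \<open>k\<close> on, fatness at the root makes the size of the levels strictly increase.  The level
  \<open>n + f n\<close> therefore has room for a node outside any set of size \<open>f n\<close> when \<open>n \<ge> k\<close>.
\<close>

lemma card_Lev_ge:
  assumes "p \<in> FSP"
  obtains k where "\<And>n. card (Lev (k + n) p) > n"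
proof -
  have p: "perfect p"
    using assms by (rule FSP_perfect)
  have "[] \<in> p"
    using assms by (intro Nil_in_tree FSP_is_tree)
  then obtain k where k: "\<And>n. n + 1 \<ge> k \<Longrightarrow> \<exists>t'\<in>Lev n (restr p []). t' \<in> Split p"
    using FSP_fat[OF assms] by blast
  have step: "card (Lev n p) < card (Lev (Suc n) p)" if n: "n \<ge> k" for n
  proof -
    obtain s where "s \<in> Lev n (restr p [])" "s \<in> Split p"
      using k[of n] n by auto
    then show ?thesis
      using p by (intro card_Lev_Suc[of p s]) (auto simp: Lev_def restr_iff)
  qed
  have "card (Lev (Suc k + n) p) > n" for n
  proof (induction n)
    case 0
    show ?case using step[of k] by simp
  next
    case (Suc n)
    then show ?case using step[of "Suc k + n"] by simp
  qed
  then show thesis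
    by (rule that)
qed

lemma FSP_Lev_nonempty:
  assumes "p \<in> FSP"
  obtains t where "t \<in> p" "length t = n"
proof -
  have "\<exists>t\<in>p. length t = n"
  proof (induction n)
    case 0
    show ?case using Nil_in_tree[OF FSP_is_tree[OF assms]] by auto
  next
    case (Suc n)
    then obtain t where "t \<in> p" "length t = n" by blast
    moreover obtain b where "t @ [b] \<in> p"
      using perfect_extend[OF FSP_perfect[OF assms] \<open>t \<in> p\<close>] by blast
    ultimately show ?case by (intro bexI[of _ "t @ [b]"]) auto
  qed
  then show thesis using that by blast
qed

text \<open>
  Fatness and perfectness at a node of the restriction come from \<open>p\<close> at an extension of that node
  which also extends \<open>t\<close>.
\<close>

lemma restr_in_FSP:
  assumes "p \<in> FSP" "t \<in> p"
  shows "restr p t \<in> FSP"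
proof -
  have tree: "is_tree p"
    using assms(1) by (rule FSP_is_tree)
  have tree_restr: "is_tree (restr p t)"
    unfolding is_tree_def
  proof (intro conjI ballI allI impI)
    show "restr p t \<noteq> {}"
      using assms(2) by (auto simp: restr_iff)
    fix s s' assume s: "s \<in> restr p t" "prefix s' s"
    then have "s' \<in> p"
      using is_tree_prefix[OF tree] by (auto simp: restr_iff)
    moreover have "prefix s' t \<or> prefix t s'"
      using s by (metis restr_iff prefix_order.trans prefix_same_cases)
    ultimately show "s' \<in> restr p t"
      by (simp add: restr_iff)
  qed
  \<comment> \<open>A node of the restriction is comparable with \<open>t\<close>; whatever happens above the longer of the two
    is the same in \<open>p\<close> and in the restriction.\<close>
  have longer: "\<exists>u\<in>p. prefix s u \<and> prefix t u" if "s \<in> restr p t" for s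
    using that assms(2) by (auto simp: restr_iff)
  have Split_above: "s \<in> Split (restr p t)" if "s \<in> Split p" "prefix t s" for s
    using that by (auto simp: Defs.Split_def restr_iff)
  have "\<exists>s'\<in>Split (restr p t). prefix s s'" if s: "s \<in> restr p t" for s
  proof -
    obtain u where u: "u \<in> p" "prefix s u" "prefix t u"
      using longer[OF s] by blast
    obtain s' where "s' \<in> Split p" "prefix u s'"
      using FSP_perfect[OF assms(1)] u(1) by (auto simp: perfect_def)
    then show ?thesis
      using u Split_above by (meson prefix_order.trans)
  qed
  moreover have "\<exists>k. \<forall>n. n + 1 \<ge> k \<longrightarrow>
      (\<exists>t'\<in>Lev n (restr (restr p t) s). t' \<in> Split (restr p t))" if s: "s \<in> restr p t" for s
  proof -
    obtain u where u: "u \<in> p" "prefix s u" "prefix t u"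
      using longer[OF s] by blast
    obtain k where k: "\<And>n. n + 1 \<ge> k \<Longrightarrow> \<exists>t'\<in>Lev n (restr p u). t' \<in> Split p"
      using FSP_fat[OF assms(1) u(1)] by blast
    \<comment> \<open>At levels from the length of \<open>u\<close> on, being comparable with \<open>u\<close> means extending it.\<close>
    have "\<exists>t'\<in>Lev n (restr (restr p t) s). t' \<in> Split (restr p t)" if n: "n + 1 \<ge> k + length u + 1" for n
    proof -
      obtain t' where t': "t' \<in> Lev n (restr p u)" "t' \<in> Split p"
        using k[of n] n by auto
      then have "prefix u t'"
        using n by (auto simp: Lev_def restr_iff prefix_def)
      then have "prefix s t'" "prefix t t'"
        using u by (auto intro: prefix_order.trans)
      then show ?thesis
        using t' Split_above by (intro bexI[of _ t']) (auto simp: Lev_def restr_iff)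
    qed
    then show ?thesis by blast
  qed
  ultimately show ?thesis
    using tree_restr by (simp add: FSP_def perfect_def)
qed

text \<open>The condition saying no more than that \<open>t\<close> lies on the generic branch.\<close>

abbreviation cone :: "node \<Rightarrow> node set" where
  "cone t \<equiv> restr top t"

lemma restr_le_cone: "restr p t \<le> cone t"
  by (auto simp: restr_iff)

lemma restr_le: "restr p t \<le> p"
  by (auto simp: restr_iff)

text \<open>
  Conditions contain nodes of every length, so the generic branch has only one initial segment of each.
\<close>

lemma FSP_le_cones_eq:
  assumes "p \<in> FSP" "p \<le> cone t" "p \<le> cone u" "length t = length u"
  shows "t = u"
proof -
  obtain s where s: "s \<in> p" "length s = length t"
    using FSP_Lev_nonempty[OF assms(1)] .
  have "s = v" if "p \<le> cone v" "length v = length s" for v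
  proof -
    have "prefix s v \<or> prefix v s"
      using that s by (auto simp: restr_iff)
    then show ?thesis
      using that(2) by (auto simp: prefix_def)
  qed
  then show ?thesis
    using assms s by metis
qed

section \<open>The name of the sequence of initial segments of the generic branch\<close>

text \<open>
  The pairs \<open>(n, code of t)\<close> with \<open>t\<close> of length \<open>b n\<close>, each with the condition \<open>cone t\<close>.  There are
  only countably many of them, so the number in the index enumerates them all; repeating
  every pair for each second component of the index does not change the set.
\<close>

definition branch_name :: "(nat \<Rightarrow> nat) \<Rightarrow> node set name" where
  "branch_name b = Name (\<lambda>(i, _). let (n, t) = from_nat i in
     if length t = b n then Some (opair_name (nat_name n) (nat_name (to_nat t)), cone t) else None)"

lemma elts_branch_name:
  "elts (branch_name b) =
     {(opair_name (nat_name n) (nat_name (to_nat t)), cone t) |n t. length t = b n}"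
  (is "?L = ?R")
proof (intro equalityI subsetI)
  fix x assume "x \<in> ?L"
  then show "x \<in> ?R"
    by (fastforce simp: branch_name_def ran_def Let_def case_prod_beta split: if_splits)
next
  fix x assume "x \<in> ?R"
  then obtain n t where "x = (opair_name (nat_name n) (nat_name (to_nat t)), cone t)" "length t = b n"
    by blast
  then show "x \<in> ?L"
    unfolding branch_name_def elts.simps by (intro ranI[of _ "(to_nat (n, t), undefined)"]) simp
qed

lemma is_name_branch_name: "is_name FSP (branch_name b)"
  by (rule is_name.intros)
    (auto simp: elts_branch_name intro!: restr_in_FSP top_in_FSP is_name_opair_name is_name_nat_name)

lemma forces_mem_branch_nameI:
  assumes "p \<le> cone t" "length t = b n"
  shows "forces_mem FSP p (opair_name (nat_name n) (nat_name (to_nat t))) (branch_name b)"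
  by (rule forces_memI[OF _ assms(1)]) (use assms(2) in \<open>auto simp: elts_branch_name\<close>)

text \<open>
  Forced membership only provides a pair in the name that is forced equal to the given one; as the
  canonical names of distinct pairs are never forced equal, it is the given one.
\<close>

lemma forces_mem_branch_nameE:
  assumes "forces_mem FSP p (opair_name (nat_name n) (nat_name k)) (branch_name b)"
    "q \<in> FSP" "q \<le> p"
  obtains q' t where "q' \<in> FSP" "q' \<le> q" "q' \<le> cone t" "length t = b n" "k = to_nat t"
proof -
  obtain \<pi> r q' where *: "(\<pi>, r) \<in> elts (branch_name b)" "q' \<in> FSP" "q' \<le> q" "q' \<le> r"
    "forces_eq FSP q' (opair_name (nat_name n) (nat_name k)) \<pi>"
    using forces_memE[OF assms] by metis
  then obtain m t where t: "\<pi> = opair_name (nat_name m) (nat_name (to_nat t))" "r = cone t"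
      "length t = b m"
    by (auto simp: elts_branch_name)
  then have "n = m \<and> k = to_nat t"
    using * by (intro possibly_eq_opair_nat_nameD[of FSP]) (auto simp: possibly_eq_def)
  then show thesis
    using that * t by blast
qed

lemma forced_in_Baire_branch_name: "FSP \<tturnstile> in_Baire (branch_name b)"
proof -
  let ?\<tau> = "branch_name b"
  have pairs: "forces FSP (Ball_in ?\<tau> (\<lambda>x. Bex_in omega_name (\<lambda>n. Bex_in omega_name (\<lambda>k.
      Equal x (opair_name n k))))) p" for p
    unfolding forces.simps(5) elts_branch_name
    by (auto intro!: forces_Bex_inI[OF nat_name_in_omega_name] forces_eq_refl)
  have total: "forces FSP (Ball_in omega_name (\<lambda>n. Bex_in omega_name (\<lambda>k.
      Mem (opair_name n k) ?\<tau>))) p" for p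
  proof -
    have "\<exists>r\<in>FSP. r \<le> q \<and> (\<exists>k. forces_mem FSP r (opair_name (nat_name n) (nat_name k)) ?\<tau>)"
      if q: "q \<in> FSP" for q n
    proof -
      obtain t where t: "t \<in> q" "length t = b n"
        using FSP_Lev_nonempty[OF q] .
      have "forces_mem FSP (restr q t) (opair_name (nat_name n) (nat_name (to_nat t))) ?\<tau>"
        by (intro forces_mem_branch_nameI restr_le_cone t(2))
      then show ?thesis
        using restr_in_FSP[OF q t(1)] restr_le by blast
    qed
    then show ?thesis
      by (simp add: forces_Bex_in elts_omega_name dense_below_def)
  qed
  have single_valued: "\<exists>r\<in>FSP. r \<le> q \<and> forces_eq FSP r (nat_name k) (nat_name l)"
    if q: "q \<in> FSP" and
      k: "forces_mem FSP q (opair_name (nat_name n) (nat_name k)) ?\<tau>" and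
      l: "forces_mem FSP q (opair_name (nat_name n) (nat_name l)) ?\<tau>" for q n k l
  proof -
    obtain r t where r: "r \<in> FSP" "r \<le> q" "r \<le> cone t" "length t = b n" "k = to_nat t"
      using forces_mem_branch_nameE[OF k q order_refl] .
    obtain r' u where r': "r' \<in> FSP" "r' \<le> r" "r' \<le> cone u" "length u = b n" "l = to_nat u"
      using forces_mem_branch_nameE[OF l r(1,2)] .
    have "t = u"
      using r r' by (intro FSP_le_cones_eq[of r']) auto
    then show ?thesis
      using r r' q by (auto intro: forces_eq_refl)
  qed
  have "forces FSP (Ball_in omega_name (\<lambda>n. Ball_in omega_name (\<lambda>k. Ball_in omega_name (\<lambda>l.
      Imp (And (Mem (opair_name n k) ?\<tau>) (Mem (opair_name n l) ?\<tau>)) (Equal k l))))) p" for p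
    using single_valued by (auto simp: elts_omega_name Imp_def)
  with pairs total show ?thesis
    unfolding forced_def in_Baire_def forces.simps(4) by blast
qed

lemma forces_escapes_at_branch_name:
  assumes "length t = b n" "to_nat t \<notin> S n" "p \<le> cone t"
  shows "forces FSP (escapes_at (branch_name b) S (nat_name n)) p"
proof -
  have range: "(nat_set_name (S n), top) \<in> elts (set_seq_range_name S)"
    by (auto simp: set_seq_range_name_def elts_seq_name ran_def)
  have "forces_mem FSP q (opair_name (nat_name n) (nat_name (to_nat t))) (branch_name b)"
    if "q \<le> p" for q
    using that assms by (intro forces_mem_branch_nameI) auto
  moreover have "forces_mem FSP q (opair_name (nat_name n) (nat_set_name (S n))) (set_seq_name S)" for q
    by (rule forces_memI[of _ top]) (auto simp: set_seq_name_def elts_seq_name ran_def)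
  moreover have "forces FSP (Neg (Mem (nat_name (to_nat t)) (nat_set_name (S n)))) q" for q
    using not_forces_mem_nat_set_name[OF assms(2)] by auto
  ultimately have "forces FSP (And (Mem (opair_name (nat_name n) (nat_name (to_nat t))) (branch_name b))
      (And (Mem (opair_name (nat_name n) (nat_set_name (S n))) (set_seq_name S))
        (Neg (Mem (nat_name (to_nat t)) (nat_set_name (S n)))))) q" if "q \<le> p" for q
    using that by simp
  then show ?thesis
    unfolding escapes_at_def
    by (intro forces_Bex_inI[OF nat_name_in_omega_name] forces_Bex_inI[OF range]) auto
qed

theorem lemma6p2:
  fixes f :: "nat \<Rightarrow> nat"
  assumes "\<forall>n. f n \<noteq> 0"
  shows "\<exists>\<tau>. is_name FSP \<tau> \<and> (FSP \<tturnstile> in_Baire \<tau>) \<and>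
           (\<forall>S. slalom f S \<longrightarrow> (FSP \<tturnstile> Infinitely_often (escapes_at \<tau> S)))"
proof -
  let ?b = "\<lambda>n. n + f n"
  let ?\<tau> = "branch_name ?b"
  have "FSP \<tturnstile> Infinitely_often (escapes_at ?\<tau> S)" if S: "slalom f S" for S
  proof -
    have escape: "\<exists>r\<in>FSP. r \<le> q \<and> (\<exists>n. forces_mem FSP r (nat_name m) (nat_name n) \<and>
        forces FSP (escapes_at ?\<tau> S (nat_name n)) r)" if q: "q \<in> FSP" for q m
    proof -
      obtain k where k: "\<And>n. card (Lev (k + n) q) > n"
        using card_Lev_ge[OF q] by blast
      \<comment> \<open>Beyond \<open>k\<close> for the count, and beyond \<open>m\<close> for the escapes to be unbounded.\<close>
      define n where "n = k + Suc m"
      have "finite (S n)" and "card (S n) \<le> f n"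
        using S by (auto simp: slalom_def)
      note this(2)
      also have "f n < card (Lev (?b n) q)"
        using k[of "Suc m + f n"] by (simp add: n_def add.assoc)
      also have "\<dots> = card (to_nat ` Lev (?b n) q)"
        by (simp add: card_image inj_on_def)
      finally have "\<not> to_nat ` Lev (?b n) q \<subseteq> S n"
        using \<open>finite (S n)\<close> by (meson card_mono not_le)
      then obtain t where t: "t \<in> q" "length t = ?b n" "to_nat t \<notin> S n"
        by (auto simp: Lev_def)
      have "forces FSP (escapes_at ?\<tau> S (nat_name n)) (restr q t)"
        using t by (intro forces_escapes_at_branch_name[of t] restr_le_cone) auto
      moreover have "forces_mem FSP (restr q t) (nat_name m) (nat_name n)"
        by (rule forces_memI[of _ top]) (auto simp: elts_nat_name n_def)
      ultimately show ?thesis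
        using restr_in_FSP[OF q t(1)] restr_le by blast
    qed
    then show ?thesis
      by (simp add: forced_def Infinitely_often_def forces_Bex_in elts_omega_name dense_below_def)
  qed
  then show ?thesis
    using is_name_branch_name forced_in_Baire_branch_name by blast
qed

end
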